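(* Let $\Omega$ be a nonempty set, $Y$ a real Banach space, and let $M$ be a nonempty bounded subset of $\mathcal{TB}(\Omega,Y)$. Then $$\max\left\{\sigma_\gamma(M),\ \tfrac12\,\omega(M)\right\}\le\gamma_{\mathcal{TB}}(M)\le\mu_\gamma(M)+\omega(M).$$
   Context: $\mathcal{TB}=\mathcal{TB}(\Omega,Y)$ is the Banach space of all totally bounded functions $f:\Omega\to Y$ (i.e. $f(\Omega)$ is relatively compact in $Y$) with norm $\|f\|_\infty=\sup_{x\in\Omega}\|f(x)\|$. For a nonempty bounded subset $M$ of a Banach space $E$, the Hausdorff measure of noncompactness $\gamma_E(M)$ is the infimum of all $\varepsilon>0$ such that $M$ has a finite $\varepsilon$-net in $E$, i.e. there is a finite set $F\subseteq E$ (not necessarily contained in $M$) such that every point of $M$ is at distance at most $\varepsilon$ from some point of $F$; $\gamma=\gamma_Y$. For a bounded set $M$ of functions, $M(x)=\{f(x):f\in M\}$ for $x\in\Omega$, $M(\Omega)=\{f(x):x\in\Omega,\ f\in M\}$, $\mu_\gamma(M)=\sup_{x\in\Omega}\gamma(M(x))$, $\sigma_\gamma(M)=\gamma(M(\Omega))$, and $\omega(M)$ is the infimum of all $\varepsilon>0$ for which there is a finite partition $\{A_1,\dots,A_n\}$ of $\Omega$ such that, for all $f\in M$, $\operatorname{diam}(f(A_i))\le\varepsilon$ for $i=1,\dots,n$. *)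

theory Defs
  imports "HOL-Analysis.Analysis" "HOL-Library.Disjoint_Sets"
begin

definition relatively_compact :: "'b::topological_space set \<Rightarrow> bool" where
  "relatively_compact S \<longleftrightarrow> compact (closure S)"

lemma relatively_compact_subset:
  fixes S K :: "'b::t2_space set"
  assumes "compact K" "S \<subseteq> K"
  shows "relatively_compact S"
proof -
  have "closure S \<subseteq> K"
    using assms by (simp add: closure_minimal compact_imp_closed)
  then have "closure S = K \<inter> closure S" by blast
  then show ?thesis
    unfolding relatively_compact_def
    using compact_Int_closed[OF assms(1), of "closure S"] by simp
qed

lemma relatively_compact_iff:
  fixes S :: "'b::banach set"
  shows "relatively_compact S \<longleftrightarrow> (\<forall>e>0. \<exists>k. finite k \<and> S \<subseteq> (\<Union>x\<in>k. ball x e))"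
proof
  assume "relatively_compact S"
  then have "\<forall>e>0. \<exists>k. finite k \<and> closure S \<subseteq> (\<Union>x\<in>k. ball x e)"
    unfolding relatively_compact_def compact_eq_totally_bounded by blast
  then show "\<forall>e>0. \<exists>k. finite k \<and> S \<subseteq> (\<Union>x\<in>k. ball x e)"
    using closure_subset by (meson order_trans)
next
  assume *: "\<forall>e>0. \<exists>k. finite k \<and> S \<subseteq> (\<Union>x\<in>k. ball x e)"
  have "\<exists>k. finite k \<and> closure S \<subseteq> (\<Union>x\<in>k. ball x e)" if "e > 0" for e
  proof -
    obtain k where k: "finite k" "S \<subseteq> (\<Union>x\<in>k. ball x (e/2))"
      using * \<open>e > 0\<close> half_gt_zero by blast
    have "S \<subseteq> (\<Union>x\<in>k. cball x (e/2))"
      using k(2) ball_subset_cball by blast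
    then have "closure S \<subseteq> (\<Union>x\<in>k. cball x (e/2))"
      using k(1) by (intro closure_minimal) auto
    moreover have "cball x (e/2) \<subseteq> ball x e" for x
      using \<open>e > 0\<close> by (simp add: subset_iff)
    ultimately have "closure S \<subseteq> (\<Union>x\<in>k. ball x e)"
      by blast
    then show ?thesis using k(1) by blast
  qed
  then show "relatively_compact S"
    unfolding relatively_compact_def compact_eq_totally_bounded
    by (simp add: complete_eq_closed)
qed

text \<open>The set \<open>\<Omega>\<close> is the (automatically nonempty) type of arguments.\<close>

typedef (overloaded) ('a, 'b) tbfun = "{f :: 'a \<Rightarrow> 'b::banach. relatively_compact (range f)}"
  morphisms apply_tb Tbfun
  by (rule exI[of _ "\<lambda>_. 0"]) (simp add: relatively_compact_def)

setup_lifting type_definition_tbfun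

lemma relatively_compact_apply_tb: "relatively_compact (range (apply_tb f))"
  using apply_tb[of f] by simp

lemma bounded_range_apply_tb: "bounded (range (apply_tb f))"
  by (rule bounded_subset[OF compact_imp_bounded closure_subset])
    (use relatively_compact_apply_tb[of f] in \<open>simp add: relatively_compact_def\<close>)

lemma relatively_compact_add:
  fixes f g :: "'a \<Rightarrow> 'b::banach"
  assumes "relatively_compact (range f)" "relatively_compact (range g)"
  shows "relatively_compact (range (\<lambda>x. f x + g x))"
proof (rule relatively_compact_subset)
  show "compact {x + y |x y. x \<in> closure (range f) \<and> y \<in> closure (range g)}"
    using assms unfolding relatively_compact_def by (rule compact_sums)
  show "range (\<lambda>x. f x + g x) \<subseteq> {x + y |x y. x \<in> closure (range f) \<and> y \<in> closure (range g)}"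
    using closure_subset[of "range f"] closure_subset[of "range g"] by blast
qed

lemma relatively_compact_scaleR:
  fixes f :: "'a \<Rightarrow> 'b::banach"
  assumes "relatively_compact (range f)"
  shows "relatively_compact (range (\<lambda>x. c *\<^sub>R f x))"
proof (rule relatively_compact_subset)
  show "compact ((*\<^sub>R) c ` closure (range f))"
    using assms unfolding relatively_compact_def by (rule compact_scaling)
  show "range (\<lambda>x. c *\<^sub>R f x) \<subseteq> (*\<^sub>R) c ` closure (range f)"
    using closure_subset[of "range f"] by blast
qed

instantiation tbfun :: (type, banach) real_vector
begin

lift_definition zero_tbfun :: "('a, 'b) tbfun" is "\<lambda>_. 0"
  by (simp add: relatively_compact_def)

lift_definition plus_tbfun :: "('a, 'b) tbfun \<Rightarrow> ('a, 'b) tbfun \<Rightarrow> ('a, 'b) tbfun"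
  is "\<lambda>f g x. f x + g x"
  by (rule relatively_compact_add)

lift_definition scaleR_tbfun :: "real \<Rightarrow> ('a, 'b) tbfun \<Rightarrow> ('a, 'b) tbfun"
  is "\<lambda>c f x. c *\<^sub>R f x"
  by (rule relatively_compact_scaleR)

lift_definition uminus_tbfun :: "('a, 'b) tbfun \<Rightarrow> ('a, 'b) tbfun"
  is "\<lambda>f x. - f x"
  subgoal for f
    using relatively_compact_scaleR[of f "-1"] by simp
  done

lift_definition minus_tbfun :: "('a, 'b) tbfun \<Rightarrow> ('a, 'b) tbfun \<Rightarrow> ('a, 'b) tbfun"
  is "\<lambda>f g x. f x - g x"
  subgoal for f g
    using relatively_compact_add[of f "\<lambda>x. (-1) *\<^sub>R g x"] relatively_compact_scaleR[of g "-1"] by simp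
  done

instance
proof
  fix f g h :: "('a, 'b) tbfun" and a b :: real
  show "f + g + h = f + (g + h)" by transfer (simp add: add.assoc)
  show "f + g = g + f" by transfer (simp add: add.commute)
  show "0 + f = f" by transfer simp
  show "- f + f = 0" by transfer simp
  show "f - g = f + - g" by transfer simp
  show "a *\<^sub>R (f + g) = a *\<^sub>R f + a *\<^sub>R g" by transfer (simp add: scaleR_add_right)
  show "(a + b) *\<^sub>R f = a *\<^sub>R f + b *\<^sub>R f" by transfer (simp add: scaleR_add_left)
  show "a *\<^sub>R b *\<^sub>R f = (a * b) *\<^sub>R f" by transfer simp
  show "1 *\<^sub>R f = f" by transfer simp
qed

end

instantiation tbfun :: (type, banach) real_normed_vector
begin

definition norm_tbfun :: "('a, 'b) tbfun \<Rightarrow> real" where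
  "norm_tbfun f = (SUP x. norm (apply_tb f x))"

definition dist_tbfun :: "('a, 'b) tbfun \<Rightarrow> ('a, 'b) tbfun \<Rightarrow> real" where
  "dist_tbfun f g = norm (f - g)"

definition sgn_tbfun :: "('a, 'b) tbfun \<Rightarrow> ('a, 'b) tbfun" where
  "sgn_tbfun f = f /\<^sub>R norm f"

definition uniformity_tbfun :: "(('a, 'b) tbfun \<times> ('a, 'b) tbfun) filter" where
  "uniformity_tbfun = (INF e\<in>{0<..}. principal {(f, g). dist f g < e})"

definition open_tbfun :: "('a, 'b) tbfun set \<Rightarrow> bool" where
  "open_tbfun U \<longleftrightarrow> (\<forall>f\<in>U. eventually (\<lambda>(f', g). f' = f \<longrightarrow> g \<in> U) uniformity)"

lemma bdd_above_norm_tb: "bdd_above (range (\<lambda>x. norm (apply_tb f x)))"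
  using bounded_range_apply_tb[of f] unfolding bounded_iff bdd_above_def by auto

lemma norm_apply_tb_le: "norm (apply_tb f x) \<le> norm f"
  unfolding norm_tbfun_def by (rule cSUP_upper[OF UNIV_I bdd_above_norm_tb])

lemma norm_tb_le: "(\<And>x. norm (apply_tb f x) \<le> C) \<Longrightarrow> norm f \<le> C"
  unfolding norm_tbfun_def by (rule cSUP_least) auto

instance
proof
  fix f g :: "('a, 'b) tbfun" and c :: real
  show "dist f g = norm (f - g)" by (rule dist_tbfun_def)
  show "sgn f = f /\<^sub>R norm f" by (rule sgn_tbfun_def)
  show "(uniformity :: (('a, 'b) tbfun \<times> ('a, 'b) tbfun) filter)
      = (INF e\<in>{0<..}. principal {(f, g). dist f g < e})"
    by (rule uniformity_tbfun_def)
  show "open U \<longleftrightarrow> (\<forall>f\<in>U. eventually (\<lambda>(f', g). f' = f \<longrightarrow> g \<in> U) uniformity)"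
    for U :: "('a, 'b) tbfun set"
    by (rule open_tbfun_def)
  show "norm f = 0 \<longleftrightarrow> f = 0"
  proof
    assume "norm f = 0"
    then have "apply_tb f x = 0" for x
      using norm_apply_tb_le[of f x] by simp
    then show "f = 0" by (transfer) auto
  next
    assume "f = 0"
    then show "norm f = 0" by (simp add: norm_tbfun_def zero_tbfun.rep_eq)
  qed
  show "norm (f + g) \<le> norm f + norm g"
    by (rule norm_tb_le)
      (metis plus_tbfun.rep_eq norm_triangle_mono norm_apply_tb_le)
  show "norm (c *\<^sub>R f) = \<bar>c\<bar> * norm f"
  proof (rule antisym)
    show "norm (c *\<^sub>R f) \<le> \<bar>c\<bar> * norm f"
      by (rule norm_tb_le) (simp add: scaleR_tbfun.rep_eq mult_left_mono norm_apply_tb_le)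
    show "\<bar>c\<bar> * norm f \<le> norm (c *\<^sub>R f)"
    proof (cases "c = 0")
      case True
      have "0 \<le> norm (c *\<^sub>R f)"
        using norm_apply_tb_le norm_ge_zero order_trans by blast
      with True show ?thesis by simp
    next
      case False
      have "norm f \<le> norm (c *\<^sub>R f) / \<bar>c\<bar>"
        by (rule norm_tb_le)
          (use False norm_apply_tb_le[of "c *\<^sub>R f"] in
            \<open>simp add: scaleR_tbfun.rep_eq field_simps\<close>)
      with False show ?thesis by (simp add: field_simps)
    qed
  qed
qed

end

instance tbfun :: (type, banach) banach
proof
  fix X :: "nat \<Rightarrow> ('a, 'b) tbfun"
  assume "Cauchy X"
  have pt: "dist (apply_tb f x) (apply_tb g x) \<le> dist f g" for f g :: "('a, 'b) tbfun" and x
    using norm_apply_tb_le[of "f - g" x] by (simp add: dist_norm minus_tbfun.rep_eq)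
  have "Cauchy (\<lambda>n. apply_tb (X n) x)" for x
    using \<open>Cauchy X\<close> pt unfolding Cauchy_def by (meson order_le_less_trans)
  then have "convergent (\<lambda>n. apply_tb (X n) x)" for x
    by (rule Cauchy_convergent)
  then obtain l where l: "\<And>x. (\<lambda>n. apply_tb (X n) x) \<longlonglongrightarrow> l x"
    unfolding convergent_def by metis
  have unif: "\<exists>N. \<forall>n\<ge>N. \<forall>x. dist (apply_tb (X n) x) (l x) \<le> e" if "e > 0" for e
  proof -
    obtain N where N: "\<And>m n. m \<ge> N \<Longrightarrow> n \<ge> N \<Longrightarrow> dist (X m) (X n) < e"
      using \<open>Cauchy X\<close> \<open>e > 0\<close> unfolding Cauchy_def by meson
    have "dist (apply_tb (X n) x) (l x) \<le> e" if "n \<ge> N" for n x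
    proof (rule tendsto_upperbound)
      show "(\<lambda>m. dist (apply_tb (X n) x) (apply_tb (X m) x))
          \<longlonglongrightarrow> dist (apply_tb (X n) x) (l x)"
        by (intro tendsto_intros l)
      show "\<forall>\<^sub>F m in sequentially. dist (apply_tb (X n) x) (apply_tb (X m) x) \<le> e"
        using eventually_ge_at_top[of N]
      proof eventually_elim
        case (elim m)
        then show ?case
          using pt[of "X n" x "X m"] N[OF that, of m] by linarith
      qed
    qed simp
    then show ?thesis by blast
  qed
  have "relatively_compact (range l)"
    unfolding relatively_compact_iff
  proof (intro allI impI)
    fix e :: real
    assume "e > 0"
    then obtain n where n: "\<And>x. dist (apply_tb (X n) x) (l x) \<le> e / 2"
      using unif[of "e / 2"] by auto
    obtain k where k: "finite k" "range (apply_tb (X n)) \<subseteq> (\<Union>y\<in>k. ball y (e / 2))"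
      using relatively_compact_apply_tb[of "X n"] \<open>e > 0\<close> half_gt_zero
      unfolding relatively_compact_iff by blast
    have "\<exists>y\<in>k. l x \<in> ball y e" for x
    proof -
      obtain y where y: "y \<in> k" "dist y (apply_tb (X n) x) < e / 2"
        using k(2) by (auto simp: subset_iff)
      then have "dist y (l x) < e"
        using n[of x] dist_triangle[of y "l x" "apply_tb (X n) x"] by linarith
      with y(1) show ?thesis by auto
    qed
    then show "\<exists>k. finite k \<and> range l \<subseteq> (\<Union>x\<in>k. ball x e)"
      using k(1) by blast
  qed
  then have L: "apply_tb (Tbfun l) = l"
    by (simp add: Tbfun_inverse)
  have "X \<longlonglongrightarrow> Tbfun l"
  proof (rule LIMSEQ_I)
    fix r :: real
    assume "r > 0"
    then obtain N where N: "\<And>n x. n \<ge> N \<Longrightarrow> dist (apply_tb (X n) x) (l x) \<le> r / 2"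
      using unif[of "r / 2"] by auto
    have "norm (X n - Tbfun l) \<le> r / 2" if "n \<ge> N" for n
      using N[OF that] by (intro norm_tb_le) (simp add: minus_tbfun.rep_eq L dist_norm)
    then show "\<exists>no. \<forall>n\<ge>no. norm (X n - Tbfun l) < r"
      using \<open>r > 0\<close> by (intro exI[of _ N]) force
  qed
  then show "convergent X" by (rule convergentI)
qed

text \<open>The centres of a finite net range over the whole space. In the infima below, the set of
  admissible \<open>\<epsilon>\<close> is nonempty, and the supremum defining \<open>\<mu>\<^sub>\<gamma>\<close> is finite, for bounded
  \<open>M\<close>; on unbounded sets the values are meaningless.\<close>

definition hausdorff_mnc :: "'e::banach set \<Rightarrow> real" where
  "hausdorff_mnc M =
    Inf {\<epsilon>. \<epsilon> > 0 \<and> (\<exists>F. finite F \<and> (\<forall>x\<in>M. \<exists>y\<in>F. dist x y \<le> \<epsilon>))}"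

definition eval_at :: "('a, 'b::banach) tbfun set \<Rightarrow> 'a \<Rightarrow> 'b set" where
  "eval_at M x = {apply_tb f x |f. f \<in> M}"

definition eval_all :: "('a, 'b::banach) tbfun set \<Rightarrow> 'b set" where
  "eval_all M = {apply_tb f x |x f. f \<in> M}"

definition mu_gamma :: "('a, 'b::banach) tbfun set \<Rightarrow> real" where
  "mu_gamma M = (SUP x. hausdorff_mnc (eval_at M x))"

definition sigma_gamma :: "('a, 'b::banach) tbfun set \<Rightarrow> real" where
  "sigma_gamma M = hausdorff_mnc (eval_all M)"

definition omega :: "('a, 'b::banach) tbfun set \<Rightarrow> real" where
  "omega M =
    Inf {\<epsilon>. \<epsilon> > 0 \<and> (\<exists>P. finite P \<and> partition_on UNIV P \<and>
      (\<forall>f\<in>M. \<forall>A\<in>P. diameter (apply_tb f ` A) \<le> \<epsilon>))}"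

end

theory Submission
  imports Defs
begin

text \<open>A finite net of \<open>M\<close> in \<open>\<T>\<B>\<close> consists of finitely many functions with relatively compact
  ranges. The union of these ranges has finite \<open>\<delta>\<close>-nets, which bounds \<open>\<sigma>\<^sub>\<gamma>\<close>; and one finite
  partition makes all of them oscillate by at most \<open>\<delta>\<close> on each part, so that every member of \<open>M\<close>
  oscillates by at most \<open>2\<epsilon> + \<delta>\<close>. Conversely, for a partition adapted to \<open>\<omega>(M)\<close>, choose a point in
  each part and a finite net of \<open>M\<close> at that point; the finitely many step functions with values in
  these nets form a net of \<open>M\<close>.\<close>

section \<open>Finite nets and their radii\<close>

lemma hausdorff_mnc_le:
  assumes "0 \<le> e" "finite F" and F: "\<And>x. x \<in> S \<Longrightarrow> \<exists>y\<in>F. dist x y \<le> e"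
  shows "hausdorff_mnc S \<le> e"
proof (rule field_le_epsilon)
  \<comment> \<open>Only positive radii enter the infimum, whereas \<open>e\<close> may be 0;
    \<open>e + d\<close> is positive, and \<open>F\<close> is still a net at that radius.\<close>
  fix d :: real
  assume "0 < d"
  let ?E = "{e. 0 < e \<and> (\<exists>F. finite F \<and> (\<forall>x\<in>S. \<exists>y\<in>F. dist x y \<le> e))}"
  have "\<forall>x\<in>S. \<exists>y\<in>F. dist x y \<le> e + d"
    using F \<open>0 < d\<close> by (meson add_increasing2 less_imp_le)
  then have "e + d \<in> ?E"
    using \<open>0 \<le> e\<close> \<open>0 < d\<close> \<open>finite F\<close> by auto
  moreover have "bdd_below ?E"
    by (rule bdd_belowI[of _ 0]) auto
  ultimately show "hausdorff_mnc S \<le> e + d"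
    unfolding hausdorff_mnc_def by (rule cInf_lower)
qed

text \<open>The single centre 0 is a net whose radius is any norm bound of \<open>S\<close>. This
  keeps \<open>Inf\<close> away from the empty set, where its value carries no information.\<close>

lemma hausdorff_mnc_set_nonempty:
  fixes S :: "'e::banach set"
  assumes "bounded S"
  shows "{e. 0 < e \<and> (\<exists>F. finite F \<and> (\<forall>x\<in>S. \<exists>y\<in>F. dist x y \<le> e))} \<noteq> {}"
proof -
  obtain B where "0 < B" "\<And>x. x \<in> S \<Longrightarrow> norm x \<le> B"
    using assms unfolding bounded_pos by blast
  then have "0 < B \<and> (\<exists>F. finite F \<and> (\<forall>x\<in>S. \<exists>y\<in>F. dist x y \<le> B))"
    by (intro conjI exI[of _ "{0}"]) auto
  then show ?thesis by blast
qed

lemma hausdorff_mnc_net: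
  fixes S :: "'e::banach set"
  assumes "bounded S" "hausdorff_mnc S < e"
  obtains F where "finite F" "\<And>x. x \<in> S \<Longrightarrow> \<exists>y\<in>F. dist x y \<le> e"
proof -
  obtain d F where "d < e" "finite F" and F: "\<And>x. x \<in> S \<Longrightarrow> \<exists>y\<in>F. dist x y \<le> d"
    using cInf_lessD[OF hausdorff_mnc_set_nonempty[OF assms(1)] assms(2)[unfolded hausdorff_mnc_def]]
    by blast
  show thesis
  proof (rule that[OF \<open>finite F\<close>])
    show "\<exists>y\<in>F. dist x y \<le> e" if "x \<in> S" for x
      using F[OF that] \<open>d < e\<close> by (meson less_imp_le order_trans)
  qed
qed

text \<open>Reduces a lower bound for the measure of noncompactness to a claim about one arbitrary
  finite net.\<close>

lemma hausdorff_mnc_greatest: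
  fixes S :: "'e::banach set"
  assumes "bounded S"
    and "\<And>e F. \<lbrakk>0 < e; finite F; \<And>x. x \<in> S \<Longrightarrow> \<exists>y\<in>F. dist x y \<le> e\<rbrakk> \<Longrightarrow> c \<le> e"
  shows "c \<le> hausdorff_mnc S"
  unfolding hausdorff_mnc_def
  by (rule cInf_greatest[OF hausdorff_mnc_set_nonempty[OF assms(1)]]) (use assms(2) in blast)

section \<open>The supremum metric and the sets of values\<close>

lemma dist_apply_tb_le: "dist (apply_tb f x) (apply_tb g x) \<le> dist f g"
  using norm_apply_tb_le[of "f - g" x] by (simp add: dist_norm minus_tbfun.rep_eq)

lemma dist_tb_le: "(\<And>x. dist (apply_tb f x) (apply_tb g x) \<le> c) \<Longrightarrow> dist f g \<le> c"
  using norm_tb_le[of "f - g" c] by (simp add: dist_norm minus_tbfun.rep_eq)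

lemma bounded_eval_all:
  assumes "bounded M"
  shows "bounded (eval_all M)"
proof -
  obtain B where "\<And>f. f \<in> M \<Longrightarrow> norm f \<le> B"
    using assms unfolding bounded_iff by blast
  then show ?thesis
    unfolding bounded_iff eval_all_def
    by (intro exI[of _ B]) (auto intro: order_trans[OF norm_apply_tb_le])
qed

lemma eval_at_subset_eval_all: "eval_at M x \<subseteq> eval_all M"
  unfolding eval_at_def eval_all_def by blast

text \<open>A norm bound of \<open>eval_all M\<close> serves as a radius for the net
  \<open>{0}\<close> at every point simultaneously, so the supremum in \<open>mu_gamma\<close> is
  over a family that is bounded above.\<close>

lemma hausdorff_mnc_eval_at_le_mu_gamma:
  assumes "bounded M"
  shows "hausdorff_mnc (eval_at M x) \<le> mu_gamma M"
  unfolding mu_gamma_def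
proof (rule cSUP_upper[OF UNIV_I])
  obtain B where "0 < B" "\<And>y. y \<in> eval_all M \<Longrightarrow> norm y \<le> B"
    using bounded_eval_all[OF assms] unfolding bounded_pos by blast
  then have "hausdorff_mnc (eval_at M x) \<le> B" for x
    using eval_at_subset_eval_all[of M x] by (intro hausdorff_mnc_le[of B "{0}"]) auto
  then show "bdd_above (range (\<lambda>x. hausdorff_mnc (eval_at M x)))"
    by (auto simp: bdd_above_def)
qed

section \<open>Finite partitions of the domain\<close>

lemma omega_le:
  assumes "0 < e" "finite P" "partition_on UNIV P"
    and "\<And>f A. f \<in> M \<Longrightarrow> A \<in> P \<Longrightarrow> diameter (apply_tb f ` A) \<le> e"
  shows "omega M \<le> e"
  unfolding omega_def
proof (rule cInf_lower)
  show "bdd_below {e. 0 < e \<and> (\<exists>P. finite P \<and> partition_on UNIV P \<and>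
      (\<forall>f\<in>M. \<forall>A\<in>P. diameter (apply_tb f ` A) \<le> e))}"
    by (rule bdd_belowI[of _ 0]) auto
qed (use assms in blast)

text \<open>If \<open>B\<close> bounds all values of members of \<open>M\<close>, the one-part
  partition \<open>{UNIV}\<close> admits \<open>2 * B\<close>. The infimum is thus over a nonempty
  set, and some admissible \<open>d < e\<close> exists.\<close>

lemma omega_partition:
  fixes M :: "('a, 'b::banach) tbfun set"
  assumes "bounded M" "omega M < e"
  obtains P where "finite P" "partition_on UNIV P"
    "\<And>f A. f \<in> M \<Longrightarrow> A \<in> P \<Longrightarrow> diameter (apply_tb f ` A) \<le> e"
proof -
  let ?E = "{e. 0 < e \<and> (\<exists>P. finite P \<and> partition_on UNIV P \<and>
      (\<forall>f\<in>M. \<forall>A\<in>P. diameter (apply_tb f ` A) \<le> e))}"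
  obtain B where B: "0 < B" "\<And>y. y \<in> eval_all M \<Longrightarrow> norm y \<le> B"
    using bounded_eval_all[OF assms(1)] unfolding bounded_pos by blast
  have "diameter (range (apply_tb f)) \<le> 2 * B" if "f \<in> M" for f
  proof (rule diameter_le)
    have le: "norm (apply_tb f x) \<le> B" for x
      using B(2) that unfolding eval_all_def by blast
    fix y z
    assume "y \<in> range (apply_tb f)" "z \<in> range (apply_tb f)"
    then have "norm y \<le> B" "norm z \<le> B"
      using le by auto
    then show "norm (y - z) \<le> 2 * B"
      using norm_triangle_ineq4[of y z] by linarith
  qed (use B in auto)
  then have "2 * B \<in> ?E"
    using B(1) by (auto intro!: exI[of _ "{UNIV}"] simp: partition_on_def)
  then have "?E \<noteq> {}" by blast
  from cInf_lessD[OF this assms(2)[unfolded omega_def]]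
  obtain d P where "d < e" and P: "finite P" "partition_on UNIV P"
    and d: "\<And>f A. f \<in> M \<Longrightarrow> A \<in> P \<Longrightarrow> diameter (apply_tb f ` A) \<le> d"
    by blast
  show thesis
    by (rule that[OF P]) (use d \<open>d < e\<close> in fastforce)
qed

lemma partition_on_fibres: "partition_on UNIV (range (\<lambda>x. h -` {h x}))"
  by (rule partition_onI) (auto simp: disjnt_iff)

text \<open>Each \<open>g\<close> is replaced, up to \<open>d / 2\<close>, by a map
  \<open>c g\<close> into a finite set. Points at which all the maps \<open>c g\<close> agree are
  put into one part, and there each \<open>g\<close> varies by at most \<open>d\<close>.\<close>

lemma relatively_compact_finite_partition:
  fixes G :: "('a \<Rightarrow> 'b::banach) set"
  assumes "finite G" "\<And>g. g \<in> G \<Longrightarrow> relatively_compact (range g)" "0 < d"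
  obtains P where "finite P" "partition_on UNIV P"
    "\<And>g A x y. \<lbrakk>g \<in> G; A \<in> P; x \<in> A; y \<in> A\<rbrakk> \<Longrightarrow> dist (g x) (g y) \<le> d"
proof -
  have "\<exists>k c. finite k \<and> (\<forall>x. c x \<in> k \<and> dist (g x) (c x) \<le> d / 2)" if g: "g \<in> G" for g
  proof -
    obtain k where k: "finite k" "range g \<subseteq> (\<Union>y\<in>k. ball y (d / 2))"
      using assms(2)[OF g] \<open>0 < d\<close> half_gt_zero unfolding relatively_compact_iff by blast
    have "\<exists>y. y \<in> k \<and> dist (g x) y \<le> d / 2" for x
    proof -
      obtain y where "y \<in> k" "g x \<in> ball y (d / 2)"
        using k(2) by blast
      then show ?thesis by (auto simp: dist_commute intro: less_imp_le)
    qed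
    with k(1) show ?thesis by metis
  qed
  then obtain k c where k: "\<And>g. g \<in> G \<Longrightarrow> finite (k g)"
    and c: "\<And>g x. g \<in> G \<Longrightarrow> c g x \<in> k g" "\<And>g x. g \<in> G \<Longrightarrow> dist (g x) (c g x) \<le> d / 2"
    by metis
  \<comment> \<open>\<open>h x\<close> collects all the approximations at \<open>x\<close>.
    Restricting to \<open>G\<close> fixes its values elsewhere, so that it lies in a finite product;
    its fibres are the parts.\<close>
  define h where "h x = restrict (\<lambda>g. c g x) G" for x
  have "finite (range h)"
    by (rule finite_subset[of _ "Pi\<^sub>E G k"]) (auto simp: h_def c intro: finite_PiE assms k)
  then have "finite (range (\<lambda>x. h -` {h x}))"
    using finite_imageI[of "range h" "\<lambda>v. h -` {v}"] by (simp add: image_image)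
  then show thesis
  proof (rule that[OF _ partition_on_fibres])
    fix g A x y
    assume "g \<in> G" "A \<in> range (\<lambda>x. h -` {h x})" "x \<in> A" "y \<in> A"
    then have "h x = h y" by auto
    then have "c g x = c g y"
      using \<open>g \<in> G\<close> unfolding h_def by (metis restrict_apply')
    then show "dist (g x) (g y) \<le> d"
      using c(2)[OF \<open>g \<in> G\<close>, of x] c(2)[OF \<open>g \<in> G\<close>, of y] dist_triangle2[of "g x" "g y" "c g x"]
      by simp
  qed
qed

section \<open>The two lower bounds\<close>

lemma sigma_gamma_le_hausdorff_mnc:
  fixes M :: "('a, 'b::banach) tbfun set"
  assumes "bounded M"
  shows "sigma_gamma M \<le> hausdorff_mnc M"
proof (rule hausdorff_mnc_greatest[OF assms])
  fix e and F :: "('a, 'b) tbfun set"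
  assume "0 < e" "finite F" and F: "\<And>f. f \<in> M \<Longrightarrow> \<exists>g\<in>F. dist f g \<le> e"
  show "sigma_gamma M \<le> e"
  proof (rule field_le_epsilon)
    fix d :: real
    assume "0 < d"
    then have "\<forall>g. \<exists>k. finite k \<and> range (apply_tb g) \<subseteq> (\<Union>y\<in>k. ball y d)"
      for g :: "('a, 'b) tbfun"
      using relatively_compact_apply_tb unfolding relatively_compact_iff by blast
    then obtain k where k: "\<And>g :: ('a, 'b) tbfun. finite (k g)"
      "\<And>g :: ('a, 'b) tbfun. range (apply_tb g) \<subseteq> (\<Union>y\<in>k g. ball y d)"
      by metis
    show "sigma_gamma M \<le> e + d"
      unfolding sigma_gamma_def
    proof (rule hausdorff_mnc_le)
      \<comment> \<open>The net for all values is the union of \<open>d\<close>-nets of the ranges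
        of the centres: \<open>f x\<close> is within \<open>e\<close> of \<open>g x\<close>,
        uniformly in \<open>x\<close>, and \<open>g x\<close> is within \<open>d\<close> of
        \<open>k g\<close>.\<close>
      show "finite (\<Union>g\<in>F. k g)"
        using \<open>finite F\<close> k(1) by blast
      fix z
      assume "z \<in> eval_all M"
      then obtain f x where f: "f \<in> M" "z = apply_tb f x"
        unfolding eval_all_def by blast
      obtain g where g: "g \<in> F" "dist f g \<le> e"
        using F f(1) by blast
      obtain y where y: "y \<in> k g" "dist y (apply_tb g x) < d"
        using k(2)[of g] by (auto simp: subset_iff)
      have "dist z y \<le> e + d"
        using dist_apply_tb_le[of f x g] g(2) y(2) dist_triangle2[of z y "apply_tb g x"]
        unfolding f(2) by linarith
      with g(1) y(1) show "\<exists>y\<in>\<Union>g\<in>F. k g. dist z y \<le> e + d" by blast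
    qed (use \<open>0 < e\<close> \<open>0 < d\<close> in simp)
  qed
qed

text \<open>The factor 2 arises because replacing \<open>f\<close> by a nearby centre
  \<open>g\<close> costs \<open>e\<close> at each of the two points compared.\<close>

lemma omega_le_hausdorff_mnc:
  fixes M :: "('a, 'b::banach) tbfun set"
  assumes "bounded M"
  shows "1 / 2 * omega M \<le> hausdorff_mnc M"
proof (rule hausdorff_mnc_greatest[OF assms])
  fix e and F :: "('a, 'b) tbfun set"
  assume "0 < e" "finite F" and F: "\<And>f. f \<in> M \<Longrightarrow> \<exists>g\<in>F. dist f g \<le> e"
  have "omega M \<le> 2 * e"
  proof (rule field_le_epsilon)
    fix d :: real
    assume "0 < d"
    \<comment> \<open>The partition depends only on the centres and \<open>d\<close>, hence serves
      all \<open>f\<close> in \<open>M\<close> together, as \<open>omega\<close> demands.\<close>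
    obtain P where P: "finite P" "partition_on UNIV P"
      and d: "\<And>g A x y. \<lbrakk>g \<in> apply_tb ` F; A \<in> P; x \<in> A; y \<in> A\<rbrakk> \<Longrightarrow> dist (g x) (g y) \<le> d"
      by (rule relatively_compact_finite_partition[of "apply_tb ` F" d])
        (use \<open>finite F\<close> \<open>0 < d\<close> relatively_compact_apply_tb in auto)
    show "omega M \<le> 2 * e + d"
    proof (rule omega_le[OF _ P])
      fix f A
      assume "f \<in> M" "A \<in> P"
      then obtain g where g: "g \<in> F" "dist f g \<le> e"
        using F by blast
      have "dist (apply_tb f x) (apply_tb f y) \<le> 2 * e + d" if "x \<in> A" "y \<in> A" for x y
        using d[OF imageI[OF g(1)] \<open>A \<in> P\<close> that] g(2)
          dist_apply_tb_le[of f x g] dist_apply_tb_le[of f y g]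
          dist_triangle[of "apply_tb f x" "apply_tb f y" "apply_tb g x"]
          dist_triangle2[of "apply_tb g x" "apply_tb f y" "apply_tb g y"]
        by linarith
      then show "diameter (apply_tb f ` A) \<le> 2 * e + d"
        using \<open>0 < e\<close> \<open>0 < d\<close> by (intro diameter_le) (auto simp: dist_norm)
    qed (use \<open>0 < e\<close> \<open>0 < d\<close> in simp)
  qed
  then show "1 / 2 * omega M \<le> e" by simp
qed

section \<open>The upper bound by step functions\<close>

lemma finite_imp_relatively_compact:
  fixes S :: "'b::t2_space set"
  shows "finite S \<Longrightarrow> relatively_compact S"
  by (rule relatively_compact_subset[OF finite_imp_compact]) auto

lemma hausdorff_mnc_le_mu_gamma_omega:
  fixes M :: "('a, 'b::banach) tbfun set"
  assumes "M \<noteq> {}" "bounded M"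
  shows "hausdorff_mnc M \<le> mu_gamma M + omega M"
proof (rule field_le_epsilon)
  fix d :: real
  assume "0 < d"
  \<comment> \<open>Infima need not be attained, so half of the slack \<open>d\<close> goes to the
    nets of values and half to the partition.\<close>
  let ?m = "mu_gamma M + d / 2" and ?w = "omega M + d / 2"
  obtain P where P: "finite P" "partition_on UNIV P"
    and diam: "\<And>f A. f \<in> M \<Longrightarrow> A \<in> P \<Longrightarrow> diameter (apply_tb f ` A) \<le> ?w"
    by (rule omega_partition[OF assms(2), of ?w]) (use \<open>0 < d\<close> in auto)
  have "\<exists>N. finite N \<and> (\<forall>z\<in>eval_at M x. \<exists>y\<in>N. dist z y \<le> ?m)" for x
  proof (rule hausdorff_mnc_net)
    show "bounded (eval_at M x)"
      by (rule bounded_subset[OF bounded_eval_all eval_at_subset_eval_all]) (rule assms)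
    show "hausdorff_mnc (eval_at M x) < ?m"
      using hausdorff_mnc_eval_at_le_mu_gamma[OF assms(2), of x] \<open>0 < d\<close> by linarith
  qed blast
  then obtain N where N: "\<And>x. finite (N x)"
    "\<And>x f. f \<in> M \<Longrightarrow> \<exists>y\<in>N x. dist (apply_tb f x) y \<le> ?m"
    unfolding eval_at_def by (simp, metis)
  have "\<exists>A. A \<in> P \<and> x \<in> A" for x
    using partition_onD1[OF P(2)] by blast
  then obtain part where part: "\<And>x. part x \<in> P" "\<And>x. x \<in> part x"
    by metis
  have "\<exists>x. x \<in> A" if "A \<in> P" for A
    using partition_onD3[OF P(2)] that by (metis ex_in_conv)
  then obtain pt where pt: "\<And>A. A \<in> P \<Longrightarrow> pt A \<in> A"
    by metis
  \<comment> \<open>Only the values of \<open>\<phi>\<close> on the finite set \<open>P\<close>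
    matter, so \<open>step \<phi>\<close> has finite range and does lie in the function
    space.\<close>
  define step where "step \<phi> = Tbfun (\<lambda>x. \<phi> (part x))" for \<phi> :: "'a set \<Rightarrow> 'b"
  have step: "apply_tb (step \<phi>) = (\<lambda>x. \<phi> (part x))" for \<phi>
  proof -
    have "finite (range (\<lambda>x. \<phi> (part x)))"
      by (rule finite_subset[of _ "\<phi> ` P"]) (use part P in auto)
    then show ?thesis
      unfolding step_def by (simp add: Tbfun_inverse finite_imp_relatively_compact)
  qed
  let ?F = "step ` (\<Pi>\<^sub>E A\<in>P. N (pt A))"
  have net: "\<exists>g\<in>?F. dist f g \<le> ?m + ?w" if f: "f \<in> M" for f
  proof -
    \<comment> \<open>\<open>\<psi>\<close> selects a net point near \<open>f x\<close> at every
      \<open>x\<close>, but only its values at the finitely many sample points \<open>pt A\<close>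
      enter \<open>\<phi>\<close>.\<close>
    obtain \<psi> where \<psi>: "\<And>x. \<psi> x \<in> N x" "\<And>x. dist (apply_tb f x) (\<psi> x) \<le> ?m"
      using N(2)[OF f] by metis
    define \<phi> where "\<phi> = restrict (\<lambda>A. \<psi> (pt A)) P"
    have "dist (apply_tb f x) (apply_tb (step \<phi>) x) \<le> ?m + ?w" for x
    proof -
      \<comment> \<open>Moving from \<open>x\<close> to the sample point of its part costs at most
        \<open>?w\<close>; passing from there to the net costs at most \<open>?m\<close>. The
        diameter controls distances because the range of \<open>f\<close> is bounded.\<close>
      have "dist (apply_tb f x) (apply_tb f (pt (part x))) \<le> diameter (apply_tb f ` part x)"
        by (rule diameter_bounded_bound[OF bounded_subset[OF bounded_range_apply_tb[of f]]])
          (use part pt in auto)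
      then show ?thesis
        using diam[OF f part(1)[of x]] \<psi>(2)[of "pt (part x)"] part(1)[of x]
          dist_triangle[of "apply_tb f x" "\<psi> (pt (part x))" "apply_tb f (pt (part x))"]
        by (simp add: step \<phi>_def)
    qed
    moreover have "\<phi> \<in> (\<Pi>\<^sub>E A\<in>P. N (pt A))"
      using \<psi>(1) by (auto simp: \<phi>_def)
    ultimately show ?thesis
      by (blast intro: dist_tb_le)
  qed
  have "hausdorff_mnc M \<le> ?m + ?w"
  proof (rule hausdorff_mnc_le[OF _ _ net])
    \<comment> \<open>Since \<open>M\<close> has a member, \<open>net\<close> puts an actual
      distance below this sum.\<close>
    show "0 \<le> ?m + ?w"
      using net assms(1) by (meson ex_in_conv order_trans zero_le_dist)
    show "finite ?F"
      using P(1) N(1) by (intro finite_imageI finite_PiE)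
  qed
  then show "hausdorff_mnc M \<le> mu_gamma M + omega M + d" by simp
qed

theorem theorem3p5:
  fixes M :: "('a, 'b::banach) tbfun set"
  assumes "M \<noteq> {}" and "bounded M"
  shows "max (sigma_gamma M) (1 / 2 * omega M) \<le> hausdorff_mnc M \<and>
    hausdorff_mnc M \<le> mu_gamma M + omega M"
  using sigma_gamma_le_hausdorff_mnc[OF assms(2)] omega_le_hausdorff_mnc[OF assms(2)]
    hausdorff_mnc_le_mu_gamma_omega[OF assms] by simp

end
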